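(* The quasi-Newton method $$\widetilde J_{3,k}\begin{bmatrix} x_{k+1}-x_k\\ \mu_{k+1}-\mu_k\end{bmatrix}=-\begin{bmatrix} M(\mu_k)x_k\\ c^Hx_k-1\end{bmatrix}$$ with the modified Jacobian matrix $$\widetilde J_{3,k}:=\begin{bmatrix} M(\sigma) & M[\mu_{k+1},\mu_k]x_k\\ c^H & 0\end{bmatrix}$$ is equivalent to residual inverse iteration as described by Neumaier (1985).
   Context: $\Omega\subset\mathbb{C}$ is a closed set, and $M:\Omega\to\mathbb{C}^{n\times n}$ is analytic in $\Omega$. The nonlinear eigenvalue problem is to find $\lambda\in\Omega$ and $v\ne 0$ with $M(\lambda)v=0$; with a vector $c\in\mathbb{C}^n$ it is written as the system $M(\lambda)v=0$, $c^Hv-1=0$. The superscript $H$ denotes conjugate transpose, $\sigma=\mu_0$ is the starting value for the eigenvalue, and $(\mu_k,x_k)$ are the successive approximations of an eigenpair $(\lambda,v)$. The divided difference is $M[\lambda,\mu]=\frac{M(\lambda)-M(\mu)}{\lambda-\mu}$ if $\lambda\neq\mu$ and $M[\lambda,\lambda]=M'(\lambda)$. The last row of the quasi-Newton relation gives $c^Hx_1=c^Hx_2=\cdots=1$, so all iterates except possibly the first are normalized. Residual inverse iteration, with $w_\sigma^H:=c^HM(\sigma)^{-1}$, is the iteration which, given $x_k$, determines $\mu_{k+1}$ from the scalar equation $w_\sigma^HM(\mu_{k+1})x_k=0$ (the value of the Rayleigh functional) and then sets $x_{k+1}=x_k-M(\sigma)^{-1}M(\mu_{k+1})x_k$. *)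

theory Defs
  imports "HOL-Analysis.Analysis"
begin

(* Analyticity, derivative and scaling of matrix functions are taken entrywise:
   the type of complex matrices carries only a real normed space structure in the library. *)
definition analytic_matrix_on ::
    "(complex \<Rightarrow> complex^'n^'n) \<Rightarrow> complex set \<Rightarrow> bool" where
  "analytic_matrix_on M \<Omega> \<longleftrightarrow> (\<forall>i j. (\<lambda>z. M z $ i $ j) analytic_on \<Omega>)"

definition matrix_deriv :: "(complex \<Rightarrow> complex^'n^'n) \<Rightarrow> complex \<Rightarrow> complex^'n^'n" where
  "matrix_deriv M z = (\<chi> i j. deriv (\<lambda>w. M w $ i $ j) z)"

definition divided_difference ::
    "(complex \<Rightarrow> complex^'n^'n) \<Rightarrow> complex \<Rightarrow> complex \<Rightarrow> complex^'n^'n" where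
  "divided_difference M l m =
     (if l \<noteq> m then (\<chi> i j. (M l $ i $ j - M m $ i $ j) / (l - m)) else matrix_deriv M l)"

(* The row vector c^H. Row and column vectors share one type; the product of a row with a
   matrix is "v*" and that of a row with a column is the bilinear scalar_product. *)
definition herm :: "complex^'n \<Rightarrow> complex^'n" where
  "herm c = (\<chi> i. cnj (c $ i))"

(* In the index type 'n + 1 of the bordered system, Inl ranges over the first n positions
   and Inr over the last one. *)
definition bordered_matrix ::
    "complex^'n^'n \<Rightarrow> complex^'n \<Rightarrow> complex^'n \<Rightarrow> complex \<Rightarrow> complex^('n + 1)^('n + 1)" where
  "bordered_matrix A b r d = (\<chi> i j. case i of
      Inl p \<Rightarrow> (case j of Inl q \<Rightarrow> A $ p $ q | Inr _ \<Rightarrow> b $ p)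
    | Inr _ \<Rightarrow> (case j of Inl q \<Rightarrow> r $ q | Inr _ \<Rightarrow> d))"

definition stacked_vector :: "complex^'n \<Rightarrow> complex \<Rightarrow> complex^('n + 1)" where
  "stacked_vector y t = (\<chi> i. case i of Inl p \<Rightarrow> y $ p | Inr _ \<Rightarrow> t)"

(* The modified Jacobian for the step from (m, x) to an iterate with eigenvalue part m'. *)
definition jacobian3 ::
    "(complex \<Rightarrow> complex^'n^'n) \<Rightarrow> complex^'n \<Rightarrow> complex \<Rightarrow> complex \<Rightarrow> complex \<Rightarrow> complex^'n
      \<Rightarrow> complex^('n + 1)^('n + 1)" where
  "jacobian3 M c \<sigma> m' m x =
     bordered_matrix (M \<sigma>) (divided_difference M m' m *v x) (herm c) 0"

(* Both iterations are implicit in the new eigenvalue approximation, so a step is a relation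
   between the old pair (m, x) and the new pair (m', x'). *)
definition quasi_newton3_step ::
    "(complex \<Rightarrow> complex^'n^'n) \<Rightarrow> complex^'n \<Rightarrow> complex \<Rightarrow>
      complex \<Rightarrow> complex^'n \<Rightarrow> complex \<Rightarrow> complex^'n \<Rightarrow> bool" where
  "quasi_newton3_step M c \<sigma> m x m' x' \<longleftrightarrow>
     jacobian3 M c \<sigma> m' m x *v stacked_vector (x' - x) (m' - m) =
       - stacked_vector (M m *v x) (scalar_product (herm c) x - 1)"

definition w_row ::
    "(complex \<Rightarrow> complex^'n^'n) \<Rightarrow> complex^'n \<Rightarrow> complex \<Rightarrow> complex^'n" where
  "w_row M c \<sigma> = herm c v* matrix_inv (M \<sigma>)"

definition residual_inverse_step ::
    "(complex \<Rightarrow> complex^'n^'n) \<Rightarrow> complex^'n \<Rightarrow> complex \<Rightarrow>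
      complex^'n \<Rightarrow> complex \<Rightarrow> complex^'n \<Rightarrow> bool" where
  "residual_inverse_step M c \<sigma> x m' x' \<longleftrightarrow>
     scalar_product (w_row M c \<sigma>) (M m' *v x) = 0 \<and>
     x' = x - matrix_inv (M \<sigma>) *v (M m' *v x)"

end

theory Submission
  imports Defs
begin

text \<open>
  Multiplying the divided difference by the increment of the eigenvalue recovers the difference of
  the matrices, even when both eigenvalue approximations coincide. The first block row of the
  quasi-Newton system is therefore a linear equation with the invertible matrix \<open>M \<sigma>\<close> in which
  the old eigenvalue approximation cancels: it says exactly that the new vector is the one produced by the
  correction of residual inverse iteration. The last row says that the new vector is normalized.
  A normalized vector stays normalized under that correction if and only if the scalar equation of
  the Rayleigh functional holds, so the two steps agree on normalized vectors
  (\<open>quasi_newton3_step_iff_residual_inverse_step\<close>).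

  Both steps yield normalized vectors, the residual inverse step provided that it starts from one.
  The equivalence of a single step thus extends to sequences by induction. If the
  starting vector is arbitrary, one quasi-Newton step normalizes it, and both iterations agree
  from then on.
\<close>

lemma stacked_vector_eq_iff:
  "stacked_vector y s = stacked_vector z t \<longleftrightarrow> y = z \<and> s = t"
proof
  assume eq: "stacked_vector y s = stacked_vector z t"
  have "stacked_vector y s $ i = stacked_vector z t $ i" for i
    using eq by simp
  from this[of "Inl p" for p] this[of "Inr 1"] show "y = z \<and> s = t"
    by (simp add: stacked_vector_def vec_eq_iff)
qed simp

lemma uminus_stacked_vector: "- stacked_vector y t = stacked_vector (- y) (- t)"
  by (simp add: stacked_vector_def vec_eq_iff split: sum.split)

lemma bordered_matrix_mult_stacked_vector:
  "bordered_matrix A b r d *v stacked_vector y t =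
     stacked_vector (A *v y + t *s b) (scalar_product r y + d * t)"
  (is "?L = ?R")
proof -
  have UNIV_1: "(UNIV :: 1 set) = {1}"
    by (auto intro: num1_eq1)
  have sum_split: "(\<Sum>j\<in>UNIV. f j) = (\<Sum>q\<in>UNIV. f (Inl q)) + f (Inr 1)"
    for f :: "'a + 1 \<Rightarrow> complex"
    unfolding UNIV_Plus_UNIV[symmetric] by (simp add: sum.Plus UNIV_1 del: UNIV_Plus_UNIV)
  have "?L $ i = ?R $ i" for i
    by (cases i)
       (simp_all add: matrix_vector_mult_def bordered_matrix_def stacked_vector_def
          scalar_product_def sum_split mult.commute)
  then show ?thesis
    by (simp add: vec_eq_iff)
qed

text \<open>
  For \<open>l = m\<close> the divided difference is the derivative, but both sides vanish, so the implicit
  quasi-Newton step has no exceptional case when the eigenvalue approximation stagnates.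
\<close>

lemma divided_difference_mult:
  "(l - m) *s (divided_difference M l m *v x) = M l *v x - M m *v x"
proof -
  have "(l - m) * (divided_difference M l m $ i $ j * x $ j) =
      M l $ i $ j * x $ j - M m $ i $ j * x $ j" for i j
    by (simp add: divided_difference_def flip: left_diff_distrib)
  then show ?thesis
    by (simp add: vec_eq_iff matrix_vector_mult_def sum_distrib_left left_diff_distrib
        flip: sum_subtractf)
qed

text \<open>
  The divided difference contributes \<open>M m' *v x - M m *v x\<close> to the upper rows. Its second term cancels
  the residual at \<open>m\<close>, so the system is driven by the residual at the new approximation \<open>m'\<close>.
\<close>

lemma quasi_newton3_step_iff_rows:
  "quasi_newton3_step M c \<sigma> m x m' x' \<longleftrightarrow>
     M \<sigma> *v (x' - x) = - (M m' *v x) \<and> scalar_product (herm c) x' = 1"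
proof -
  have diff: "scalar_product (herm c) (x' - x) = scalar_product (herm c) x' - scalar_product (herm c) x"
    by (simp add: scalar_product_def algebra_simps sum_subtractf)
  show ?thesis
    unfolding quasi_newton3_step_def jacobian3_def bordered_matrix_mult_stacked_vector
      uminus_stacked_vector stacked_vector_eq_iff divided_difference_mult diff
    by (auto simp: algebra_simps)
qed

lemma scalar_product_vector_matrix_mult:
  fixes r :: "complex^'m" and A :: "complex^'n^'m"
  shows "scalar_product (r v* A) y = scalar_product r (A *v y)"
  unfolding scalar_product_def vector_matrix_mult_def matrix_vector_mult_def
  by (simp add: sum_distrib_left sum_distrib_right mult_ac) (rule sum.swap)

lemma matrix_vector_mult_eq_iff_matrix_inv:
  fixes A :: "complex^'n^'n"
  assumes "invertible A"
  shows "A *v y = b \<longleftrightarrow> y = matrix_inv A *v b"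
proof -
  have "A ** matrix_inv A = mat 1 \<and> matrix_inv A ** A = mat 1"
    using assms unfolding matrix_inv_def invertible_def by (rule someI_ex)
  then show ?thesis
    by (auto simp: matrix_vector_mul_assoc)
qed

lemma quasi_newton3_step_iff_correction:
  assumes "invertible (M \<sigma>)"
  shows "quasi_newton3_step M c \<sigma> m x m' x' \<longleftrightarrow>
     x' = x - matrix_inv (M \<sigma>) *v (M m' *v x) \<and> scalar_product (herm c) x' = 1"
proof -
  have "matrix_inv (M \<sigma>) *v (- (M m' *v x)) = - (matrix_inv (M \<sigma>) *v (M m' *v x))"
    by (simp add: matrix_vector_mult_def vec_eq_iff sum_negf)
  then show ?thesis
    unfolding quasi_newton3_step_iff_rows matrix_vector_mult_eq_iff_matrix_inv[OF assms]
    by (auto simp: algebra_simps)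
qed

text \<open>
  The row \<open>w_row M c \<sigma>\<close> is designed to measure how much the correction changes the normalization;
  the equation of the Rayleigh functional asks that this change vanish.
\<close>

lemma scalar_product_correction:
  "scalar_product (herm c) (x - matrix_inv (M \<sigma>) *v y) =
     scalar_product (herm c) x - scalar_product (w_row M c \<sigma>) y"
  unfolding w_row_def scalar_product_vector_matrix_mult
  by (simp add: scalar_product_def algebra_simps sum_subtractf)

lemma quasi_newton3_step_iff_residual_inverse_step:
  assumes "invertible (M \<sigma>)" and "scalar_product (herm c) x = 1"
  shows "quasi_newton3_step M c \<sigma> m x m' x' \<longleftrightarrow> residual_inverse_step M c \<sigma> x m' x'"
  unfolding quasi_newton3_step_iff_correction[of M \<sigma>, OF assms(1)] residual_inverse_step_def
  using assms(2) by (auto simp: scalar_product_correction)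

text \<open>
  The last row of the quasi-Newton system enforces normalization, whereas residual inverse iteration
  can only preserve it.
\<close>

lemma residual_inverse_step_normalized:
  assumes "residual_inverse_step M c \<sigma> x m' x'" and "scalar_product (herm c) x = 1"
  shows "scalar_product (herm c) x' = 1"
  using assms by (simp add: residual_inverse_step_def scalar_product_correction)

text \<open>
  The starting index \<open>n\<close> is kept general because the iterates can be normalized from the
  beginning or only after the first step.
\<close>

lemma quasi_newton3_iff_residual_inverse_from:
  assumes inv: "invertible (M \<sigma>)" and start: "scalar_product (herm c) (x n) = 1"
  shows "(\<forall>k\<ge>n. quasi_newton3_step M c \<sigma> (\<mu> k) (x k) (\<mu> (Suc k)) (x (Suc k))) \<longleftrightarrow>
         (\<forall>k\<ge>n. residual_inverse_step M c \<sigma> (x k) (\<mu> (Suc k)) (x (Suc k)))"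
    (is "(\<forall>k\<ge>n. ?Q k) \<longleftrightarrow> (\<forall>k\<ge>n. ?R k)")
proof -
  have step: "?Q k \<longleftrightarrow> ?R k" if "scalar_product (herm c) (x k) = 1" for k
    using quasi_newton3_step_iff_residual_inverse_step[of M \<sigma>, OF inv that] .
  have normalized: "scalar_product (herm c) (x k) = 1"
    if steps: "\<forall>k\<ge>n. ?Q k \<or> ?R k" and "k \<ge> n" for k
    using \<open>k \<ge> n\<close>
  proof (induction k rule: dec_induct)
    case base
    show ?case by (rule start)
  next
    case (step k)
    then have "?Q k \<or> ?R k" using steps by blast
    then show ?case
      using step.IH residual_inverse_step_normalized quasi_newton3_step_iff_rows by blast
  qed
  show ?thesis
    using step normalized by blast
qed

theorem theorem2p3:
  fixes M :: "complex \<Rightarrow> complex^'n^'n"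
    and \<Omega> :: "complex set"
    and c :: "complex^'n"
    and \<sigma> :: complex
    and \<mu> :: "nat \<Rightarrow> complex"
    and x :: "nat \<Rightarrow> complex^'n"
  assumes "closed \<Omega>"
    and "analytic_matrix_on M \<Omega>"
    and "\<And>k. \<mu> k \<in> \<Omega>"
    and "\<sigma> = \<mu> 0"
    and "invertible (M \<sigma>)"
  shows "(\<forall>k. scalar_product (herm c) (x k) = 1 \<longrightarrow>
            (quasi_newton3_step M c \<sigma> (\<mu> k) (x k) (\<mu> (Suc k)) (x (Suc k)) \<longleftrightarrow>
             residual_inverse_step M c \<sigma> (x k) (\<mu> (Suc k)) (x (Suc k)))) \<and>
         (scalar_product (herm c) (x 0) = 1 \<longrightarrow>
            ((\<forall>k. quasi_newton3_step M c \<sigma> (\<mu> k) (x k) (\<mu> (Suc k)) (x (Suc k))) \<longleftrightarrow>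
             (\<forall>k. residual_inverse_step M c \<sigma> (x k) (\<mu> (Suc k)) (x (Suc k))))) \<and>
         ((\<forall>k. quasi_newton3_step M c \<sigma> (\<mu> k) (x k) (\<mu> (Suc k)) (x (Suc k))) \<longleftrightarrow>
             quasi_newton3_step M c \<sigma> (\<mu> 0) (x 0) (\<mu> 1) (x 1) \<and>
             (\<forall>k\<ge>1. residual_inverse_step M c \<sigma> (x k) (\<mu> (Suc k)) (x (Suc k))))"
    (is "(\<forall>k. _ k \<longrightarrow> (?Q k \<longleftrightarrow> ?R k)) \<and> _ \<and> _")
proof (intro conjI)
  note inv = \<open>invertible (M \<sigma>)\<close>
  show "\<forall>k. scalar_product (herm c) (x k) = 1 \<longrightarrow> (?Q k \<longleftrightarrow> ?R k)"
    using quasi_newton3_step_iff_residual_inverse_step[of M \<sigma>, OF inv] by blast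
  show "scalar_product (herm c) (x 0) = 1 \<longrightarrow> ((\<forall>k. ?Q k) \<longleftrightarrow> (\<forall>k. ?R k))"
    using quasi_newton3_iff_residual_inverse_from[of M \<sigma> c x 0 \<mu>, OF inv] by simp
  have split: "(\<forall>k. ?Q k) \<longleftrightarrow> ?Q 0 \<and> (\<forall>k\<ge>1. ?Q k)"
    by (metis One_nat_def Suc_leI neq0_conv)
  have tail: "(\<forall>k\<ge>1. ?Q k) \<longleftrightarrow> (\<forall>k\<ge>1. ?R k)" if "?Q 0"
  proof -
    have "scalar_product (herm c) (x 1) = 1"
      using that by (simp add: quasi_newton3_step_iff_rows)
    then show ?thesis
      by (rule quasi_newton3_iff_residual_inverse_from[of M \<sigma>, OF inv])
  qed
  show "(\<forall>k. ?Q k) \<longleftrightarrow>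
      quasi_newton3_step M c \<sigma> (\<mu> 0) (x 0) (\<mu> 1) (x 1) \<and> (\<forall>k\<ge>1. ?R k)"
    using split tail by auto
qed

end
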